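(* Each continuous map $f:\mathbb{R}^2\to\mathbb{C}^2$ that preserves unit distance (i.e. preserves distance $d=1$) preserves all distances, i.e. preserves distance $d$ for every $d\geq 0$.
   Context: The map $\varphi_2:\mathbb{C}^2\times\mathbb{C}^2\to\mathbb{C}$ is $\varphi_2((x_1,x_2),(y_1,y_2))=(x_1-y_1)^2+(x_2-y_2)^2$ (no complex conjugation). A map $f:\mathbb{R}^2\to\mathbb{C}^2$ preserves distance $d\geq 0$ if for all $x,y\in\mathbb{R}^2$, $\varphi_2(x,y)=d^2$ implies $\varphi_2(f(x),f(y))=d^2$. *)

theory Defs
  imports "HOL-Analysis.Analysis"
begin

definition phi2 :: "complex ^ 2 \<Rightarrow> complex ^ 2 \<Rightarrow> complex" where
  "phi2 x y = (x $ 1 - y $ 1)\<^sup>2 + (x $ 2 - y $ 2)\<^sup>2"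

definition complex_vec :: "real ^ 2 \<Rightarrow> complex ^ 2" where
  "complex_vec x = (\<chi> i. complex_of_real (x $ i))"

text \<open>The condition on the arguments evaluates \<open>phi2\<close> on the real plane, viewed inside the
  complex plane via \<open>complex_vec\<close>. Only nonnegative \<open>d\<close> are of interest.\<close>

definition preserves_distance :: "(real ^ 2 \<Rightarrow> complex ^ 2) \<Rightarrow> real \<Rightarrow> bool" where
  "preserves_distance f d \<longleftrightarrow>
    (\<forall>x y. phi2 (complex_vec x) (complex_vec y) = (complex_of_real d)\<^sup>2 \<longrightarrow>
           phi2 (f x) (f y) = (complex_of_real d)\<^sup>2)"

end

theory Submission
  imports Defs
begin

text \<open>Two unit equilateral triangles glued along a side form a rhombus; in \<open>\<complex>\<^sup>2\<close> the images
  of the two vertices off the common side either coincide or again complete a rhombus, and the Moser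
  spindle excludes coincidence. So \<open>f\<close> sends such rhombi to parallelograms, which forces it to be affine on
  equally spaced points of every line. Stretching an isosceles triangle with legs \<open>1\<close> and base
  \<open>1/n\<close> by the factor \<open>n\<close> from its apex shows that \<open>1/n\<close> is preserved; hence all
  rational distances are, and continuity does the rest.\<close>

section \<open>Squared norms and rotations in the real plane\<close>

lemma norm_vec2_sq: "(norm (v :: real ^ 2))\<^sup>2 = (v $ 1)\<^sup>2 + (v $ 2)\<^sup>2"
  by (simp add: norm_vec_def L2_set_def sum_2)

lemma norm_vec2_eqI:
  fixes v :: "real ^ 2"
  assumes "(v $ 1)\<^sup>2 + (v $ 2)\<^sup>2 = r\<^sup>2" "r \<ge> 0"
  shows "norm v = r"
  using assms by (metis norm_vec2_sq norm_ge_zero power2_eq_imp_eq)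

lemma phi2_complex_vec:
  "phi2 (complex_vec x) (complex_vec y) = of_real ((norm (x - y))\<^sup>2)"
  by (simp add: phi2_def complex_vec_def norm_vec2_sq)

lemma preserves_distance_iff:
  assumes "d \<ge> 0"
  shows "preserves_distance f d \<longleftrightarrow>
    (\<forall>x y. norm (x - y) = d \<longrightarrow> phi2 (f x) (f y) = (of_real d)\<^sup>2)"
proof -
  have "of_real ((norm (x - y))\<^sup>2) = (complex_of_real d)\<^sup>2 \<longleftrightarrow> norm (x - y) = d"
    for x y :: "real ^ 2"
    using assms by (simp flip: of_real_power)
  then show ?thesis
    unfolding preserves_distance_def phi2_complex_vec by simp
qed

text \<open>Multiplication by the complex number \<open>c + i s\<close>, a pure rotation when
  \<open>c^2 + s^2 = 1\<close>. Other values also rescale, which is used to build the legs of a tall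
  isosceles triangle from its base.\<close>

definition rotate_vec :: "real \<Rightarrow> real \<Rightarrow> real ^ 2 \<Rightarrow> real ^ 2" where
  "rotate_vec c s v = vector [c * v $ 1 - s * v $ 2, s * v $ 1 + c * v $ 2]"

lemma rotate_vec_nth [simp]:
  "rotate_vec c s v $ 1 = c * v $ 1 - s * v $ 2"
  "rotate_vec c s v $ 2 = s * v $ 1 + c * v $ 2"
  by (simp_all add: rotate_vec_def)

lemma rotate_vec_add: "rotate_vec c s (v + w) = rotate_vec c s v + rotate_vec c s w"
  and rotate_vec_diff: "rotate_vec c s (v - w) = rotate_vec c s v - rotate_vec c s w"
  by (simp_all add: vec_eq_iff forall_2 algebra_simps)

lemma norm_rotate_vec:
  assumes "c\<^sup>2 + s\<^sup>2 = 1"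
  shows "norm (rotate_vec c s v) = norm v"
proof (rule norm_vec2_eqI)
  have "(c * v $ 1 - s * v $ 2)\<^sup>2 + (s * v $ 1 + c * v $ 2)\<^sup>2
      = (c\<^sup>2 + s\<^sup>2) * ((v $ 1)\<^sup>2 + (v $ 2)\<^sup>2)"
    by algebra
  then show "(rotate_vec c s v $ 1)\<^sup>2 + (rotate_vec c s v $ 2)\<^sup>2 = (norm v)\<^sup>2"
    by (simp add: assms norm_vec2_sq)
qed simp

section \<open>Rhombi for the complex bilinear form\<close>

text \<open>With \<open>A\<close> at the origin, \<open>D\<close> and \<open>B + C\<close> are both
  orthogonal to \<open>B - C\<close>. Since \<open>k \<noteq> 0\<close>, neither
  \<open>B - C\<close> nor \<open>B + C\<close> is isotropic, so in dimension 2 \<open>D\<close> is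
  a multiple of \<open>B + C\<close>. The side conditions leave only the factors 0 and 1.\<close>

lemma complex_rhombus:
  fixes A B C D :: "complex ^ 2"
  assumes "phi2 A B = k" "phi2 A C = k" "phi2 B C = k" "phi2 B D = k" "phi2 C D = k" "k \<noteq> 0"
  shows "D = A \<or> D = B + C - A"
proof -
  define p1 p2 q1 q2 s1 s2
    where "p1 = B $ 1 - A $ 1" and "p2 = B $ 2 - A $ 2"
      and "q1 = C $ 1 - A $ 1" and "q2 = C $ 2 - A $ 2"
      and "s1 = D $ 1 - A $ 1" and "s2 = D $ 2 - A $ 2"
  note defs = p1_def p2_def q1_def q2_def s1_def s2_def
  have pp: "p1\<^sup>2 + p2\<^sup>2 = k" and qq: "q1\<^sup>2 + q2\<^sup>2 = k"
    and pq: "(p1 - q1)\<^sup>2 + (p2 - q2)\<^sup>2 = k"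
    and ps: "(p1 - s1)\<^sup>2 + (p2 - s2)\<^sup>2 = k" and qs: "(q1 - s1)\<^sup>2 + (q2 - s2)\<^sup>2 = k"
    using assms by (simp_all add: phi2_def defs power2_commute)
  define m1 m2 where "m1 = p1 + q1" and "m2 = p2 + q2"
  have mm: "m1\<^sup>2 + m2\<^sup>2 = 3 * k"
  proof -
    have "m1\<^sup>2 + m2\<^sup>2 = 2 * (p1\<^sup>2 + p2\<^sup>2) + 2 * (q1\<^sup>2 + q2\<^sup>2) - ((p1 - q1)\<^sup>2 + (p2 - q2)\<^sup>2)"
      unfolding m1_def m2_def by algebra
    then show ?thesis
      unfolding pp qq pq by simp
  qed
  define n1 n2 where "n1 = p1 - q1" and "n2 = p2 - q2"
  have "n1 * m1 + n2 * m2 = (p1\<^sup>2 + p2\<^sup>2) - (q1\<^sup>2 + q2\<^sup>2)"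
    unfolding n1_def n2_def m1_def m2_def by algebra
  then have nm: "n1 * m1 + n2 * m2 = 0"
    by (simp add: pp qq)
  have "2 * (n1 * s1 + n2 * s2) = (p1\<^sup>2 + p2\<^sup>2) - (q1\<^sup>2 + q2\<^sup>2)
      - ((p1 - s1)\<^sup>2 + (p2 - s2)\<^sup>2) + ((q1 - s1)\<^sup>2 + (q2 - s2)\<^sup>2)"
    unfolding n1_def n2_def by algebra
  then have "2 * (n1 * s1 + n2 * s2) = 0"
    unfolding pp qq ps qs by simp
  then have ns: "n1 * s1 + n2 * s2 = 0"
    by (metis mult_eq_0_iff zero_neq_numeral)
  \<comment> \<open>The determinant of \<open>s\<close> and \<open>m\<close> is killed by
    \<open>n1\<close> and by \<open>n2\<close>, as both vectors are orthogonal to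
    \<open>n\<close>.\<close>
  have "(n1\<^sup>2 + n2\<^sup>2) * (s1 * m2 - s2 * m1) = 0"
    using nm ns by algebra
  then have "k * (s1 * m2 - s2 * m1) = 0"
    using pq by (simp add: n1_def n2_def)
  then have cross: "s1 * m2 = s2 * m1"
    using \<open>k \<noteq> 0\<close> by simp
  \<comment> \<open>The projection coefficient of \<open>s\<close> on \<open>m\<close>; the
    denominator is the form evaluated on \<open>m\<close>.\<close>
  define l where "l = (s1 * m1 + s2 * m2) / (3 * k)"
  have l: "3 * k * l = s1 * m1 + s2 * m2"
    using \<open>k \<noteq> 0\<close> by (simp add: l_def)
  have "(m1\<^sup>2 + m2\<^sup>2) * s1 = (s1 * m1 + s2 * m2) * m1"
    "(m1\<^sup>2 + m2\<^sup>2) * s2 = (s1 * m1 + s2 * m2) * m2"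
    using cross by algebra+
  then have "3 * k * s1 = 3 * k * (l * m1)" "3 * k * s2 = 3 * k * (l * m2)"
    unfolding mm l[symmetric] by (simp_all add: mult.assoc)
  then have s: "s1 = l * m1" "s2 = l * m2"
    using \<open>k \<noteq> 0\<close> by simp_all
  \<comment> \<open>\<open>D\<close> and \<open>A\<close> have the same \<open>phi2\<close> to
    \<open>B\<close>, and likewise to \<open>C\<close>. Adding the two equations shows that the form
    takes equal values on \<open>(s, s)\<close> and \<open>(s, m)\<close>, so that
    \<open>s = l m\<close> turns into \<open>l^2 = l\<close>.\<close>
  have "2 * (s1\<^sup>2 + s2\<^sup>2 - (s1 * m1 + s2 * m2)) =
      ((p1 - s1)\<^sup>2 + (p2 - s2)\<^sup>2) - (p1\<^sup>2 + p2\<^sup>2)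
      + ((q1 - s1)\<^sup>2 + (q2 - s2)\<^sup>2) - (q1\<^sup>2 + q2\<^sup>2)"
    unfolding m1_def m2_def by algebra
  then have "2 * (s1\<^sup>2 + s2\<^sup>2 - (s1 * m1 + s2 * m2)) = 0"
    unfolding pp qq ps qs by simp
  then have "s1\<^sup>2 + s2\<^sup>2 = 3 * k * l"
    unfolding l by (metis mult_eq_0_iff zero_neq_numeral right_minus_eq)
  moreover have "s1\<^sup>2 + s2\<^sup>2 = l\<^sup>2 * (m1\<^sup>2 + m2\<^sup>2)"
    unfolding s by algebra
  ultimately have "3 * k * (l * (l - 1)) = 0"
    unfolding mm by algebra
  then have "l = 0 \<or> l = 1"
    using \<open>k \<noteq> 0\<close> by simp
  then show ?thesis
  proof
    assume "l = 0"
    then show ?thesis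
      using s by (simp add: vec_eq_iff forall_2 defs)
  next
    assume "l = 1"
    then show ?thesis
      using s by (simp add: vec_eq_iff forall_2 defs m1_def m2_def algebra_simps)
  qed
qed

section \<open>Maps preserving one positive distance: rhombi go to parallelograms\<close>

context
  fixes f :: "real ^ 2 \<Rightarrow> complex ^ 2" and r :: real
  assumes r: "r > 0" and preserves: "preserves_distance f r"
begin

lemma phi2_image:
  assumes "norm (x - y) = r"
  shows "phi2 (f x) (f y) = (of_real r)\<^sup>2"
  using preserves assms r by (simp add: preserves_distance_iff)

lemma rhombus_image_cases:
  assumes "norm e = r" "norm e' = r" "norm (e - e') = r"
  shows "f (x + e + e') = f x \<or> f (x + e + e') = f (x + e) + f (x + e') - f x"
proof (rule complex_rhombus)
  show "phi2 (f x) (f (x + e)) = (of_real r)\<^sup>2" "phi2 (f x) (f (x + e')) = (of_real r)\<^sup>2"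
    "phi2 (f (x + e)) (f (x + e')) = (of_real r)\<^sup>2"
    "phi2 (f (x + e)) (f (x + e + e')) = (of_real r)\<^sup>2"
    "phi2 (f (x + e')) (f (x + e + e')) = (of_real r)\<^sup>2"
    using assms by (simp_all add: phi2_image norm_minus_commute)
  show "(complex_of_real r)\<^sup>2 \<noteq> 0"
    using r by simp
qed

text \<open>The two values belong to the collapsed and to the genuine rhombus. What matters later is
  that the squared distance of two points at distance \<open>r\<close> is neither of them.\<close>

lemma rhombus_diagonal_image:
  assumes "norm e = r" "norm e' = r" "norm (e - e') = r"
  shows "phi2 (f x) (f (x + e + e')) \<in> {0, 3 * (of_real r)\<^sup>2}"
  using rhombus_image_cases[OF assms, of x]
proof
  assume "f (x + e + e') = f x"
  then show ?thesis
    by (simp add: phi2_def)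
next
  assume D: "f (x + e + e') = f (x + e) + f (x + e') - f x"
  have "phi2 (f x) (f (x + e)) = (of_real r)\<^sup>2" "phi2 (f x) (f (x + e')) = (of_real r)\<^sup>2"
    "phi2 (f (x + e)) (f (x + e')) = (of_real r)\<^sup>2"
    using assms by (simp_all add: phi2_image)
  then have "phi2 (f x) (f (x + e + e')) = 3 * (of_real r)\<^sup>2"
    unfolding D phi2_def vector_add_component vector_minus_component by algebra
  then show ?thesis
    by simp
qed

text \<open>The parallelogram law.\<close>

lemma norm_rhombus_diagonal:
  fixes e e' :: "real ^ 2"
  assumes "norm e = r" "norm e' = r" "norm (e - e') = r"
  shows "(norm (e + e'))\<^sup>2 = 3 * r\<^sup>2"
proof -
  have "(norm (e + e'))\<^sup>2 + (norm (e - e'))\<^sup>2 = 2 * (norm e)\<^sup>2 + 2 * (norm e')\<^sup>2"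
    unfolding norm_vec2_sq vector_add_component vector_minus_component by algebra
  then show ?thesis
    using assms by simp
qed

text \<open>The Moser spindle: rotating the rhombus about \<open>x\<close> by the angle with cosine \<open>5/6\<close> moves the
  opposite vertex by exactly \<open>r\<close>.\<close>

lemma rhombus_image:
  assumes e: "norm e = r" "norm e' = r" "norm (e - e') = r"
  shows "f (x + e + e') = f (x + e) + f (x + e') - f x"
proof (rule ccontr)
  assume "\<not> ?thesis"
  then have collapse: "f (x + e + e') = f x"
    using rhombus_image_cases[OF e] by blast
  define R where "R = rotate_vec (5 / 6) (sqrt 11 / 6)"
  have unit: "(5 / 6)\<^sup>2 + (sqrt 11 / 6)\<^sup>2 = 1"
    by (simp add: power2_eq_square)
  have nR: "norm (R e) = r" "norm (R e') = r" "norm (R e - R e') = r"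
    using e norm_rotate_vec[OF unit] by (simp_all add: R_def flip: rotate_vec_diff)
  have "norm ((x + e + e') - (x + R e + R e')) = r"
  proof -
    define w where "w = e + e'"
    have sq: "(sqrt 11)\<^sup>2 = (11::real)" by simp
    \<comment> \<open>A rotation by an angle with cosine \<open>c\<close> moves \<open>w\<close> by
      a vector of squared norm \<open>2 (1 - c)\<close> times that of \<open>w\<close>. The long
      diagonal has squared length \<open>3 r^2\<close>, so the factor has to be \<open>1/3\<close>,
      whence \<open>c = 5/6\<close>.\<close>
    have "((w - R w) $ 1)\<^sup>2 + ((w - R w) $ 2)\<^sup>2 = ((w $ 1)\<^sup>2 + (w $ 2)\<^sup>2) / 3"
      unfolding R_def vector_minus_component rotate_vec_nth using sq
      by (simp add: field_simps power2_eq_square)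
    also have "\<dots> = r\<^sup>2"
      using norm_rhombus_diagonal[OF e] by (simp add: norm_vec2_sq w_def)
    finally have "norm (w - R w) = r"
      using r by (intro norm_vec2_eqI) auto
    then show ?thesis
      by (simp add: w_def R_def rotate_vec_add algebra_simps)
  qed
  \<comment> \<open>As \<open>f\<close> takes the same value at \<open>x\<close> and
    \<open>x + e + e'\<close>, the diagonal of the rotated rhombus gets the value
    \<open>r^2\<close>, which is not among its two possible values.\<close>
  then have "phi2 (f x) (f (x + R e + R e')) = (of_real r)\<^sup>2"
    using phi2_image collapse by metis
  then show False
    using rhombus_diagonal_image[OF nR, of x] r by auto
qed

section \<open>Affinity on equally spaced collinear points\<close>

text \<open>A segment and its translate along itself span no rhombus, so the translation by
  \<open>e\<close> is made in two steps \<open>a\<close> and \<open>b\<close>, at 60 degrees on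
  either side of \<open>e\<close>. Each step is a rhombus with side \<open>e\<close>, and its
  parallelogram image keeps the difference.\<close>

lemma difference_translate:
  assumes e: "norm e = r"
  shows "f (x + e + e) - f (x + e) = f (x + e) - f x"
proof -
  define a where "a = rotate_vec (1 / 2) (sqrt 3 / 2) e"
  define b where "b = rotate_vec (1 / 2) (- (sqrt 3 / 2)) e"
  have ab: "a + b = e"
    by (simp add: a_def b_def vec_eq_iff forall_2)
  have unit: "(1 / 2)\<^sup>2 + (sqrt 3 / 2)\<^sup>2 = 1" "(1 / 2)\<^sup>2 + (- (sqrt 3 / 2))\<^sup>2 = 1"
    by (simp_all add: power2_eq_square)
  have n: "norm a = r" "norm b = r"
    using e norm_rotate_vec[OF unit(1)] norm_rotate_vec[OF unit(2)] by (simp_all add: a_def b_def)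
  have "e - a = b" "e - b = a"
    using ab by auto
  then have n': "norm (e - a) = r" "norm (e - b) = r"
    using n by simp_all
  have "f (x + e + a) - f (x + a) = f (x + e) - f x"
    using rhombus_image[OF e n(1) n'(1), of x] by simp
  moreover have "f (x + a + e + b) - f (x + a + b) = f (x + a + e) - f (x + a)"
    using rhombus_image[OF e n(2) n'(2), of "x + a"] by simp
  moreover have "x + a + e + b = x + e + e" "x + a + b = x + e" "x + a + e = x + e + a"
    using ab by (simp_all add: algebra_simps)
  ultimately show ?thesis
    by metis
qed

lemma affine_on_progression:
  assumes e: "norm e = r"
  shows "f (x + real k *\<^sub>R e) = f x + of_nat k *s (f (x + e) - f x)"
proof (induction k arbitrary: x)
  case (Suc k)
  have "f (x + real (Suc k) *\<^sub>R e) = f ((x + e) + real k *\<^sub>R e)"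
    by (simp add: algebra_simps)
  also have "\<dots> = f (x + e) + of_nat k *s (f (x + e + e) - f (x + e))"
    by (rule Suc)
  also have "\<dots> = f x + of_nat (Suc k) *s (f (x + e) - f x)"
    unfolding difference_translate[OF e] by (simp add: vec_eq_iff algebra_simps)
  finally show ?case .
qed simp

section \<open>Integer multiples and integer fractions of the distance\<close>

text \<open>Cutting the segment into \<open>k\<close> steps of length \<open>r\<close> makes the
  image difference \<open>k\<close> times that of one step, and \<open>phi2\<close> is homogeneous
  of degree 2. Here \<open>r\<close> is general because \<open>1/n\<close> takes its place in the
  end.\<close>

lemma preserves_distance_mult: "preserves_distance f (real k * r)"
  unfolding preserves_distance_iff[OF mult_nonneg_nonneg[OF of_nat_0_le_iff less_imp_le[OF r]]]
proof (intro allI impI)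
  fix x y :: "real ^ 2"
  assume xy: "norm (x - y) = real k * r"
  show "phi2 (f x) (f y) = (of_real (real k * r))\<^sup>2"
  proof (cases "k = 0")
    case True
    then show ?thesis
      using xy by (simp add: phi2_def)
  next
    case False
    define e where "e = (1 / real k) *\<^sub>R (y - x)"
    have e: "norm e = r"
      using xy False by (simp add: e_def norm_minus_commute)
    have y: "y = x + real k *\<^sub>R e"
      using False by (simp add: e_def)
    have "phi2 (f x) (f y) = (of_nat k)\<^sup>2 * phi2 (f x) (f (x + e))"
      unfolding y affine_on_progression[OF e] phi2_def by (simp, algebra)
    then show ?thesis
      using e phi2_image[of x "x + e"] by (simp add: power_mult_distrib)
  qed
qed

text \<open>The points \<open>p\<close> and \<open>q\<close> are the base of an isosceles triangle
  with apex \<open>x\<close> and legs \<open>r\<close>. Stretching by \<open>n\<close> from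
  \<open>x\<close> makes the base \<open>r\<close>, a preserved distance. Since \<open>f\<close> is
  affine along both legs, the stretch multiplies \<open>phi2\<close> of the base by
  \<open>n^2\<close>, which is then cancelled.\<close>

lemma preserves_distance_divide:
  assumes n: "n > 0"
  shows "preserves_distance f (r / real n)"
proof -
  have rn: "r / real n \<ge> 0"
    using r by simp
  show ?thesis
    unfolding preserves_distance_iff[OF rn]
  proof (intro allI impI)
    fix p q :: "real ^ 2"
    assume pq: "norm (p - q) = r / real n"
    \<comment> \<open>The ratio of height to base: the legs are \<open>n\<close> times the base, so
      Pythagoras requires \<open>h^2 + 1/4 = n^2\<close>.\<close>
    define h where "h = sqrt ((real n)\<^sup>2 - 1 / 4)"
    have "(real n)\<^sup>2 \<ge> 1"
      using n by simp
    then have h: "h\<^sup>2 = (real n)\<^sup>2 - 1 / 4"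
      by (simp add: h_def)
    \<comment> \<open>The legs from the apex to \<open>q\<close> and to \<open>p\<close>: half the
      base, forwards or backwards, plus the height. Here \<open>rotate_vec\<close> rescales by
      \<open>n\<close>.\<close>
    define u where "u = rotate_vec (1 / 2) h (q - p)"
    define v where "v = rotate_vec (- 1 / 2) h (q - p)"
    have uv: "u - v = q - p"
      by (simp add: u_def v_def vec_eq_iff forall_2)
    have r2: "(real n)\<^sup>2 * ((norm (q - p))\<^sup>2) = r\<^sup>2"
      using pq n by (simp add: norm_minus_commute power_divide)
    have "(u $ 1)\<^sup>2 + (u $ 2)\<^sup>2 = (h\<^sup>2 + 1 / 4) * (norm (q - p))\<^sup>2"
      "(v $ 1)\<^sup>2 + (v $ 2)\<^sup>2 = (h\<^sup>2 + 1 / 4) * (norm (q - p))\<^sup>2"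
      unfolding u_def v_def rotate_vec_nth norm_vec2_sq by (simp_all add: field_simps power2_eq_square)
    then have nuv: "norm u = r" "norm v = r"
      using r r2 h by (auto intro!: norm_vec2_eqI)
    define x where "x = p - v"
    have p: "p = x + v" and q: "q = x + u"
      using uv by (simp_all add: x_def algebra_simps)
    have "norm ((x + real n *\<^sub>R v) - (x + real n *\<^sub>R u)) = norm (real n *\<^sub>R (p - q))"
      by (simp add: p q algebra_simps)
    also have "\<dots> = r"
      using pq n by simp
    finally have "phi2 (f (x + real n *\<^sub>R v)) (f (x + real n *\<^sub>R u)) = (of_real r)\<^sup>2"
      by (rule phi2_image)
    moreover have "phi2 (f (x + real n *\<^sub>R v)) (f (x + real n *\<^sub>R u)) = (of_nat n)\<^sup>2 * phi2 (f p) (f q)"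
      unfolding affine_on_progression[OF nuv(1)] affine_on_progression[OF nuv(2)] p q phi2_def
      by (simp, algebra)
    ultimately show "phi2 (f p) (f q) = (of_real (r / real n))\<^sup>2"
      using n by (simp add: field_simps)
  qed
qed

end

section \<open>From rational to all distances\<close>

text \<open>Sliding \<open>y\<close> along the ray from \<open>x\<close> to distance
  \<open>d n\<close> gives points that converge to \<open>y\<close>, and \<open>phi2\<close> and
  \<open>f\<close> are continuous. The ray has a direction because \<open>l > 0\<close>.\<close>

lemma preserves_distance_limit:
  assumes cont: "continuous_on UNIV f"
    and pres: "\<And>n. preserves_distance f (d n)" "\<And>n. d n \<ge> 0"
    and lim: "d \<longlonglongrightarrow> l" and "l > 0"
  shows "preserves_distance f l"
  unfolding preserves_distance_iff[OF less_imp_le[OF \<open>l > 0\<close>]]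
proof (intro allI impI)
  fix x y :: "real ^ 2"
  assume xy: "norm (x - y) = l"
  define y' where "y' n = x + (d n / l) *\<^sub>R (y - x)" for n
  have "norm (x - y' n) = d n" for n
    using xy pres(2)[of n] \<open>l > 0\<close> by (simp add: y'_def norm_minus_commute)
  then have eq: "phi2 (f x) (f (y' n)) = (of_real (d n))\<^sup>2" for n
    using pres by (simp add: preserves_distance_iff)
  have "y' \<longlonglongrightarrow> x + (l / l) *\<^sub>R (y - x)"
    unfolding y'_def using \<open>l > 0\<close> by (intro tendsto_intros lim) auto
  then have "y' \<longlonglongrightarrow> y"
    using \<open>l > 0\<close> by simp
  then have "(\<lambda>n. f (y' n)) \<longlonglongrightarrow> f y"
    using cont by (metis UNIV_I continuous_on_tendsto_compose eventually_sequentiallyI)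
  then have "(\<lambda>n. phi2 (f x) (f (y' n))) \<longlonglongrightarrow> phi2 (f x) (f y)"
    unfolding phi2_def by (intro tendsto_intros)
  moreover have "(\<lambda>n. (complex_of_real (d n))\<^sup>2) \<longlonglongrightarrow> (of_real l)\<^sup>2"
    by (intro tendsto_intros lim)
  ultimately show "phi2 (f x) (f y) = (of_real l)\<^sup>2"
    unfolding eq by (rule LIMSEQ_unique)
qed

theorem theorem2:
  fixes f :: "real ^ 2 \<Rightarrow> complex ^ 2"
  assumes "continuous_on UNIV f"
    and "preserves_distance f 1"
  shows "\<forall>d\<ge>0. preserves_distance f d"
proof (intro allI impI)
  fix d :: real
  assume "d \<ge> 0"
  \<comment> \<open>The distance 1 yields \<open>1/n\<close>, and the multiples are then taken with
    \<open>r = 1/n\<close>.\<close>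
  have frac: "preserves_distance f (real k / real n)" if "n > 0" for k n
    using preserves_distance_mult[OF _ preserves_distance_divide[OF _ assms(2) that], of k] that
    by simp
  show "preserves_distance f d"
  proof (cases "d = 0")
    \<comment> \<open>No direction is available for a limit at distance 0, so it is obtained as the
      fraction \<open>0/1\<close>.\<close>
    case True
    then show ?thesis
      using frac[where n = 1 and k = 0] by simp
  next
    case False
    \<comment> \<open>Rational approximation from below with error at most \<open>1/(n+1)\<close>;
      \<open>Suc n\<close> keeps the denominator positive, and \<open>nat\<close> loses nothing
      since \<open>d \<ge> 0\<close>.\<close>
    define a where "a n = real (nat \<lfloor>d * real (Suc n)\<rfloor>) / real (Suc n)" for n
    have "(\<lambda>n. real_of_int \<lfloor>d * real (Suc n)\<rfloor> / real (Suc n)) \<longlonglongrightarrow> d"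
    proof (rule tendsto_sandwich)
      show "\<forall>\<^sub>F n in sequentially. d - 1 / real (Suc n) \<le> real_of_int \<lfloor>d * real (Suc n)\<rfloor> / real (Suc n)"
      proof (intro always_eventually allI)
        fix n
        have "d * real (Suc n) - 1 \<le> real_of_int \<lfloor>d * real (Suc n)\<rfloor>"
          by linarith
        then show "d - 1 / real (Suc n) \<le> real_of_int \<lfloor>d * real (Suc n)\<rfloor> / real (Suc n)"
          by (simp add: pos_le_divide_eq left_diff_distrib del: of_nat_Suc)
      qed
      show "\<forall>\<^sub>F n in sequentially. real_of_int \<lfloor>d * real (Suc n)\<rfloor> / real (Suc n) \<le> d"
        by (intro always_eventually allI) (simp add: pos_divide_le_eq del: of_nat_Suc)
      show "(\<lambda>n. d - 1 / real (Suc n)) \<longlonglongrightarrow> d"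
        using tendsto_diff[OF tendsto_const LIMSEQ_Suc[OF lim_1_over_n], of d] by simp
    qed simp
    moreover have "a n = real_of_int \<lfloor>d * real (Suc n)\<rfloor> / real (Suc n)" for n
    proof -
      have "\<lfloor>d * real (Suc n)\<rfloor> \<ge> 0"
        using \<open>d \<ge> 0\<close> by simp
      then show ?thesis
        unfolding a_def by (simp only: of_nat_nat)
    qed
    ultimately have lim: "a \<longlonglongrightarrow> d"
      by presburger
    have pres: "preserves_distance f (a n)" "a n \<ge> 0" for n
      unfolding a_def by (rule frac, simp, simp del: of_nat_Suc)
    show ?thesis
      using preserves_distance_limit[OF assms(1) pres lim] False \<open>d \<ge> 0\<close> by linarith
  qed
qed

end
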